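(* Consider the system of conservation laws $$v_t+\left(\frac{v^2}{2}-\frac{m^2}{2}\right)_x=0,\qquad m_t-(mv)_x=0,$$ for $(v,m)\in\mathbb{R}\times(0,\infty)$. Let $$r_1(v,m)=\begin{bmatrix}-v+\sqrt{v^2+m^2}\\ m\end{bmatrix},\qquad r_2(v,m)=\begin{bmatrix}v+\sqrt{v^2+m^2}\\ -m\end{bmatrix}$$ be the eigenvectors of the Jacobian of the flux corresponding to the eigenvalues $\lambda_1=-\sqrt{v^2+m^2}$ and $\lambda_2=\sqrt{v^2+m^2}$, respectively. Then the functions $$w_1(v,m)=\sqrt{(m^2+v^2)^3}-v^3+3vm^2\qquad\text{and}\qquad w_2(v,m)=\sqrt{(m^2+v^2)^3}+v^3-3vm^2$$ are Riemann invariants of this system on $\mathbb{R}\times(0,\infty)$, corresponding to the eigenvectors $r_1$ and $r_2$, respectively.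
   Context: The flux of the system is $F(v,m)=\left(\frac{v^2}{2}-\frac{m^2}{2},\,-vm\right)$, defined for $v\in\mathbb{R}$, $m>0$, with Jacobian $$DF(v,m)=\begin{bmatrix} v & -m\\ -m & -v\end{bmatrix}.$$ Convention: a smooth function $w_i:\mathbb{R}\times(0,\infty)\to\mathbb{R}$ is called a Riemann invariant corresponding to the eigenvector field $r_i$ ($i=1,2$) if, at every point $(v,m)$, its gradient $\nabla w_i=(\partial_v w_i,\partial_m w_i)$ is parallel to $r_i(v,m)$, i.e. is a scalar multiple (possibly zero) of $r_i(v,m)$. The system arises from the one-dimensional, first-order forward-forward Mean-Field Game $u_t+u_x^2/2=m^2/2$, $m_t-(mu_x)_x=0$ by differentiating the first equation in $x$ and setting $v=u_x$. *)

theory Defs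
  imports "HOL-Analysis.Analysis"
begin

text \<open>A state \<open>(v, m)\<close> is a vector \<open>z :: real ^ 2\<close> with \<open>v = z $ 1\<close> and \<open>m = z $ 2\<close>.\<close>

definition state_space :: "(real ^ 2) set" where
  "state_space = {z. 0 < z $ 2}"

text \<open>The system is \<open>z\<^sub>t + (flux z)\<^sub>x = 0\<close>.\<close>

definition flux :: "real ^ 2 \<Rightarrow> real ^ 2" where
  "flux z = (let v = z $ 1; m = z $ 2 in vector [v\<^sup>2 / 2 - m\<^sup>2 / 2, - (v * m)])"

definition eigenvector :: "real ^ 'n ^ 'n \<Rightarrow> real \<Rightarrow> real ^ 'n \<Rightarrow> bool" where
  "eigenvector A l x \<longleftrightarrow> x \<noteq> 0 \<and> A *v x = l *\<^sub>R x"

text \<open>Differentiability is required explicitly because \<open>jacobian\<close> is a total function,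
  with an arbitrary value at points where \<open>F\<close> is not differentiable.\<close>

definition eigenvector_field ::
  "(real ^ 'n \<Rightarrow> real ^ 'n) \<Rightarrow> (real ^ 'n) set \<Rightarrow>
   (real ^ 'n \<Rightarrow> real) \<Rightarrow> (real ^ 'n \<Rightarrow> real ^ 'n) \<Rightarrow> bool" where
  "eigenvector_field F S l r \<longleftrightarrow>
     (\<forall>z\<in>S. F differentiable (at z) \<and> eigenvector (jacobian F (at z)) (l z) (r z))"

text \<open>\<open>Ck_on k S f\<close>, for \<open>S\<close> open, says that \<open>f\<close> is \<open>k\<close> times continuously differentiable
  on \<open>S\<close> (for finite-dimensional \<open>'a\<close>, which is the only case used).\<close>

primrec Ck_on :: "nat \<Rightarrow> 'a::real_normed_vector set \<Rightarrow> ('a \<Rightarrow> 'b::real_normed_vector) \<Rightarrow> bool" where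
  "Ck_on 0 S f \<longleftrightarrow> continuous_on S f"
| "Ck_on (Suc k) S f \<longleftrightarrow>
     (\<forall>x\<in>S. f differentiable (at x)) \<and>
     (\<forall>h. Ck_on k S (\<lambda>x. frechet_derivative f (at x) h))"

definition smooth_on :: "'a::real_normed_vector set \<Rightarrow> ('a \<Rightarrow> 'b::real_normed_vector) \<Rightarrow> bool" where
  "smooth_on S f \<longleftrightarrow> (\<forall>k. Ck_on k S f)"

definition riemann_invariant ::
  "(real ^ 'n) set \<Rightarrow> (real ^ 'n \<Rightarrow> real ^ 'n) \<Rightarrow> (real ^ 'n \<Rightarrow> real) \<Rightarrow> bool" where
  "riemann_invariant S r w \<longleftrightarrow>
     smooth_on S w \<and> (\<forall>z\<in>S. \<exists>g c. GDERIV w z :> g \<and> g = c *\<^sub>R r z)"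

definition lambda1 :: "real ^ 2 \<Rightarrow> real" where
  "lambda1 z = (let v = z $ 1; m = z $ 2 in - sqrt (v\<^sup>2 + m\<^sup>2))"

definition lambda2 :: "real ^ 2 \<Rightarrow> real" where
  "lambda2 z = (let v = z $ 1; m = z $ 2 in sqrt (v\<^sup>2 + m\<^sup>2))"

definition r1 :: "real ^ 2 \<Rightarrow> real ^ 2" where
  "r1 z = (let v = z $ 1; m = z $ 2 in vector [- v + sqrt (v\<^sup>2 + m\<^sup>2), m])"

definition r2 :: "real ^ 2 \<Rightarrow> real ^ 2" where
  "r2 z = (let v = z $ 1; m = z $ 2 in vector [v + sqrt (v\<^sup>2 + m\<^sup>2), - m])"

definition w1 :: "real ^ 2 \<Rightarrow> real" where
  "w1 z = (let v = z $ 1; m = z $ 2 in sqrt ((m\<^sup>2 + v\<^sup>2) ^ 3) - v ^ 3 + 3 * v * m\<^sup>2)"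

definition w2 :: "real ^ 2 \<Rightarrow> real" where
  "w2 z = (let v = z $ 1; m = z $ 2 in sqrt ((m\<^sup>2 + v\<^sup>2) ^ 3) + v ^ 3 - 3 * v * m\<^sup>2)"

end

theory Submission
  imports Defs
begin

text \<open>With \<open>s = sqrt (v\<^sup>2 + m\<^sup>2)\<close>, the factorizations
  \<open>m\<^sup>2 - v\<^sup>2 + s v = (s + 2 v) (s - v)\<close> and \<open>m\<^sup>2 - v\<^sup>2 - s v = (s - 2 v) (s + v)\<close>
  give \<open>\<nabla>w\<^sub>1 = 3 (s + 2 v) r\<^sub>1\<close> and \<open>\<nabla>w\<^sub>2 = 3 (2 v - s) r\<^sub>2\<close>.\<close>

section \<open>Closure properties of \<open>Ck_on\<close>\<close>

text \<open>Since \<open>S\<close> is open, agreement on \<open>S\<close> is agreement near each of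
  its points, so both functions have the same derivative there. Generalising over \<open>f\<close>
  and \<open>g\<close> lets the induction pass to the directional derivatives.\<close>

lemma Ck_on_cong:
  assumes "open S" "\<And>x. x \<in> S \<Longrightarrow> f x = g x" "Ck_on k S f"
  shows "Ck_on k S g"
  using assms(2,3)
proof (induction k arbitrary: f g)
  case 0
  then show ?case by (simp cong: continuous_on_cong)
next
  case (Suc k)
  have D: "(g has_derivative frechet_derivative f (at x)) (at x)" if "x \<in> S" for x
  proof (rule has_derivative_transform_within_open[OF _ \<open>open S\<close> that])
    show "(f has_derivative frechet_derivative f (at x)) (at x)"
      using Suc.prems(2) that by (simp add: frechet_derivative_works)
  qed (use Suc.prems(1) in auto)
  have "Ck_on k S (\<lambda>x. frechet_derivative g (at x) h)" for h
  proof (rule Suc.IH)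
    show "Ck_on k S (\<lambda>x. frechet_derivative f (at x) h)"
      using Suc.prems(2) by simp
  qed (use D frechet_derivative_at in metis)
  with D show ?case by (auto simp: differentiable_def)
qed

text \<open>Uniqueness of the derivative lets an explicit \<open>f'\<close> stand in for the choice
  made by \<open>frechet_derivative\<close>.\<close>

lemma Ck_on_SucI:
  assumes "open S" "\<And>x. x \<in> S \<Longrightarrow> (f has_derivative f' x) (at x)"
    and "\<And>h. Ck_on k S (\<lambda>x. f' x h)"
  shows "Ck_on (Suc k) S f"
proof -
  have "Ck_on k S (\<lambda>x. frechet_derivative f (at x) h)" for h
    by (rule Ck_on_cong[OF assms(1) _ assms(3)[of h]])
      (use assms(2) frechet_derivative_at in metis)
  with assms(2) show ?thesis by (auto simp: differentiable_def)
qed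

lemma Ck_on_SucD: "Ck_on (Suc k) S f \<Longrightarrow> Ck_on k S f"
proof (induction k arbitrary: f)
  case 0
  then show ?case
    by (auto intro!: continuous_at_imp_continuous_on differentiable_imp_continuous_within)
next
  case (Suc k)
  then show ?case by (metis Ck_on.simps(2))
qed

lemma Ck_on_Suc_has_derivative:
  "Ck_on (Suc k) S f \<Longrightarrow> x \<in> S \<Longrightarrow> (f has_derivative frechet_derivative f (at x)) (at x)"
  by (simp add: frechet_derivative_works)

lemma Ck_on_const: "open S \<Longrightarrow> Ck_on k S (\<lambda>x. c)"
proof (induction k arbitrary: c)
  case (Suc k)
  show ?case
    by (rule Ck_on_SucI[OF Suc.prems has_derivative_const Suc.IH[OF Suc.prems]])
qed simp

text \<open>The derivative at every point is the map itself, so for fixed \<open>h\<close> it is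
  constant in the base point and a case split replaces induction.\<close>

lemma Ck_on_bounded_linear:
  assumes "open S" "bounded_linear f"
  shows "Ck_on k S f"
proof (cases k)
  case 0
  then show ?thesis using assms by (simp add: linear_continuous_on)
next
  case (Suc j)
  have "Ck_on (Suc j) S f"
    by (rule Ck_on_SucI[OF assms(1) bounded_linear_imp_has_derivative[OF assms(2)]
          Ck_on_const[OF assms(1)]])
  with Suc show ?thesis by simp
qed

lemma Ck_on_add:
  assumes "open S" "Ck_on k S f" "Ck_on k S g"
  shows "Ck_on k S (\<lambda>x. f x + g x)"
  using assms(2,3)
proof (induction k arbitrary: f g)
  case 0
  then show ?case by (simp add: continuous_on_add)
next
  case (Suc k)
  show ?case
    by (rule Ck_on_SucI[OF assms(1) has_derivative_add])
      (use Suc in \<open>auto simp: frechet_derivative_works\<close>)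
qed

lemma Ck_on_mult:
  fixes f g :: "'a::real_normed_vector \<Rightarrow> 'b::real_normed_algebra"
  assumes "open S" "Ck_on k S f" "Ck_on k S g"
  shows "Ck_on k S (\<lambda>x. f x * g x)"
  using assms(2,3)
proof (induction k arbitrary: f g)
  case 0
  then show ?case by (simp add: continuous_on_mult)
next
  case (Suc k)
  \<comment> \<open>The product rule also contains the undifferentiated factors, which must be
    brought down to level \<open>k\<close> before the induction hypothesis applies.\<close>
  note fg = Suc.prems[THEN Ck_on_SucD]
  show ?case
  proof (rule Ck_on_SucI[OF assms(1)])
    show "((\<lambda>x. f x * g x) has_derivative
        (\<lambda>h. f x * frechet_derivative g (at x) h + frechet_derivative f (at x) h * g x)) (at x)"
      if "x \<in> S" for x
      using Suc.prems[THEN Ck_on_Suc_has_derivative, OF that] by (rule has_derivative_mult)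
    show "Ck_on k S (\<lambda>x. f x * frechet_derivative g (at x) h + frechet_derivative f (at x) h * g x)"
      for h
      by (rule Ck_on_add[OF assms(1)]; rule Suc.IH) (use fg Suc.prems in auto)
  qed
qed

lemma Ck_on_power:
  fixes f :: "'a::real_normed_vector \<Rightarrow> 'b::real_normed_algebra_1"
  assumes "open S" "Ck_on k S f"
  shows "Ck_on k S (\<lambda>x. f x ^ n)"
  using assms by (induction n) (auto intro: Ck_on_const Ck_on_mult)

text \<open>Differentiation lowers the exponent by one but stays within real powers of
  \<open>f\<close>, so the induction generalises over \<open>a\<close>. Positivity keeps
  \<open>f\<close> away from the singularity at 0.\<close>

lemma Ck_on_powr:
  fixes f :: "'a::real_normed_vector \<Rightarrow> real"
  assumes "open S" "\<And>x. x \<in> S \<Longrightarrow> 0 < f x" "Ck_on k S f"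
  shows "Ck_on k S (\<lambda>x. f x powr a)"
  using assms(3)
proof (induction k arbitrary: a)
  case 0
  then show ?case using assms(2) by (force intro!: continuous_on_powr)
next
  case (Suc k)
  show ?case
  proof (rule Ck_on_SucI[OF assms(1)])
    show "((\<lambda>x. f x powr a) has_derivative
        (\<lambda>h. frechet_derivative f (at x) h * (a * f x powr (a - 1)))) (at x)" if "x \<in> S" for x
      using DERIV_compose_FDERIV[OF has_real_derivative_powr[OF assms(2)[OF that]]
          Ck_on_Suc_has_derivative[OF Suc.prems that]] .
    show "Ck_on k S (\<lambda>x. frechet_derivative f (at x) h * (a * f x powr (a - 1)))" for h
      by (intro Ck_on_mult assms(1) Ck_on_const Suc.IH Ck_on_SucD[OF Suc.prems])
        (use Suc.prems in simp)
  qed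
qed

section \<open>The system\<close>

lemma has_derivative_vec_nth: "((\<lambda>z. z $ i) has_derivative (\<lambda>h. h $ i)) F"
  by (rule bounded_linear_imp_has_derivative[OF bounded_linear_vec_nth])

lemma open_state_space: "open state_space"
  unfolding state_space_def by (intro open_Collect_less continuous_intros)

text \<open>Both invariants are treated at once: \<open>e = -1\<close> gives \<open>w1\<close> and \<open>e = 1\<close> gives \<open>w2\<close>.\<close>

lemma smooth_on_invariant:
  "smooth_on state_space (\<lambda>z. sqrt (((z$2)\<^sup>2 + (z$1)\<^sup>2) ^ 3) + e * ((z$1) ^ 3 - 3 * z$1 * (z$2)\<^sup>2))"
  unfolding smooth_on_def
proof
  fix k
  have pos: "0 < (z$2)\<^sup>2 + (z$1)\<^sup>2" if "z \<in> state_space" for z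
    using that by (simp add: state_space_def add_pos_nonneg)
  show "Ck_on k state_space
      (\<lambda>z. sqrt (((z$2)\<^sup>2 + (z$1)\<^sup>2) ^ 3) + e * ((z$1) ^ 3 - 3 * z$1 * (z$2)\<^sup>2))"
  \<comment> \<open>The root becomes a power with exponent 1/2 and the subtraction an addition with
    coefficient -3, so that the closure lemmas cover every operation.\<close>
  proof (rule Ck_on_cong[OF open_state_space])
    show "Ck_on k state_space (\<lambda>z. (((z$2)\<^sup>2 + (z$1)\<^sup>2) ^ 3) powr (1/2)
        + e * ((z$1) ^ 3 + (-3) * z$1 * (z$2)\<^sup>2))"
      by (intro Ck_on_add Ck_on_mult Ck_on_power Ck_on_powr Ck_on_const Ck_on_bounded_linear
          bounded_linear_vec_nth open_state_space zero_less_power pos)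
  qed (simp add: powr_half_sqrt)
qed

lemma GDERIV_invariant:
  fixes z :: "real ^ 2"
  defines "s \<equiv> sqrt ((z$1)\<^sup>2 + (z$2)\<^sup>2)"
  assumes "z \<in> state_space"
  shows "GDERIV (\<lambda>z. sqrt (((z$2)\<^sup>2 + (z$1)\<^sup>2) ^ 3) + e * ((z$1) ^ 3 - 3 * z$1 * (z$2)\<^sup>2)) z
    :> vector [3 * s * z$1 + e * (3 * (z$1)\<^sup>2 - 3 * (z$2)\<^sup>2), 3 * s * z$2 - e * (6 * z$1 * z$2)]"
proof -
  have q: "0 < (z$2)\<^sup>2 + (z$1)\<^sup>2"
    using assms(2) by (simp add: state_space_def add_pos_nonneg)
  have s: "0 < s" "sqrt ((z$2)\<^sup>2 + (z$1)\<^sup>2) = s"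
    using q by (simp_all add: s_def add.commute)
  note [derivative_intros] = has_derivative_vec_nth
  have "((\<lambda>z. sqrt ((z$2)\<^sup>2 + (z$1)\<^sup>2)) has_derivative (\<lambda>h. (z$2 * h$2 + z$1 * h$1) / s)) (at z)"
    by (rule derivative_eq_intros refl q)+ (use s in \<open>simp add: fun_eq_iff field_simps\<close>)
  \<comment> \<open>The factor \<open>3 * s\<^sup>2\<close> from the cube cancels the denominator
    \<open>s\<close>.\<close>
  from has_derivative_power[OF this, of 3]
  have cube: "((\<lambda>z. sqrt ((z$2)\<^sup>2 + (z$1)\<^sup>2) ^ 3) has_derivative
      (\<lambda>h. 3 * s * (z$2 * h$2 + z$1 * h$1))) (at z)"
    by (rule has_derivative_eq_rhs) (use s in \<open>simp add: fun_eq_iff power2_eq_square\<close>)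
  have poly: "((\<lambda>z. e * ((z$1) ^ 3 - 3 * z$1 * (z$2)\<^sup>2)) has_derivative
      (\<lambda>h. e * (3 * (z$1)\<^sup>2 - 3 * (z$2)\<^sup>2) * h$1 - e * (6 * z$1 * z$2) * h$2)) (at z)"
    by (rule derivative_eq_intros refl)+ (simp add: fun_eq_iff algebra_simps)
  show ?thesis
    \<comment> \<open>The root of the cube turns into the cube of the root, the form treated in
      \<open>cube\<close>.\<close>
    unfolding gderiv_def real_sqrt_power
    by (rule has_derivative_eq_rhs[OF has_derivative_add[OF cube poly]])
      (simp add: fun_eq_iff inner_vec_def sum_2 algebra_simps)
qed

lemma flux_has_derivative:
  "(flux has_derivative
    (\<lambda>h. vector [z$1 * h$1 - z$2 * h$2, - (z$2 * h$1) - z$1 * h$2])) (at z)"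
proof -
  note [derivative_intros] = has_derivative_vec_nth
  have "((\<lambda>z. flux z $ i) has_derivative
      (\<lambda>h. vector [z$1 * h$1 - z$2 * h$2, - (z$2 * h$1) - z$1 * h$2] $ i)) (at z)" for i
  proof (cases "i = 1")
    case True
    then show ?thesis
      by (simp add: flux_def Let_def) (rule derivative_eq_intros refl | force simp: algebra_simps)+
  next
    case False
    then have "i = 2" using exhaust_2 by blast
    then show ?thesis
      by (simp add: flux_def Let_def) (rule derivative_eq_intros refl | force simp: algebra_simps)+
  qed
  then show ?thesis
    by (subst has_derivative_componentwise_within)
      (auto simp: Basis_vec_def inner_axis)
qed

lemma eigenvector_field_fluxI:
  assumes "\<And>z. z \<in> state_space \<Longrightarrow> r z \<noteq> 0"
    and "\<And>z. z \<in> state_space \<Longrightarrow> z$1 * r z$1 - z$2 * r z$2 = l z * r z$1"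
    and "\<And>z. z \<in> state_space \<Longrightarrow> - (z$2 * r z$1) - z$1 * r z$2 = l z * r z$2"
  shows "eigenvector_field flux state_space l r"
  unfolding eigenvector_field_def eigenvector_def
proof (intro ballI conjI)
  fix z :: "real ^ 2"
  assume z: "z \<in> state_space"
  show d: "flux differentiable (at z)"
    using flux_has_derivative by (auto simp: differentiable_def)
  show "r z \<noteq> 0" using assms(1) z .
  \<comment> \<open>Derivatives are unique, so the action of the Jacobian is known without computing
    its matrix entries.\<close>
  have "(*v) (jacobian flux (at z)) =
      (\<lambda>h. vector [z$1 * h$1 - z$2 * h$2, - (z$2 * h$1) - z$1 * h$2])"
    using d flux_has_derivative by (simp add: jacobian_works has_derivative_unique)
  then have "jacobian flux (at z) *v r z =
      vector [z$1 * r z$1 - z$2 * r z$2, - (z$2 * r z$1) - z$1 * r z$2]"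
    by metis
  also have "\<dots> = l z *\<^sub>R r z"
    using assms(2,3)[OF z] by (simp add: vec_eq_iff forall_2)
  finally show "jacobian flux (at z) *v r z = l z *\<^sub>R r z" .
qed

theorem proposition1:
  shows "eigenvector_field flux state_space lambda1 r1 \<and>
         eigenvector_field flux state_space lambda2 r2 \<and>
         riemann_invariant state_space r1 w1 \<and>
         riemann_invariant state_space r2 w2"
proof (intro conjI)
  \<comment> \<open>Written with products to match the terms left after expansion; the first
    components of the eigenvector and parallelism equations rest on it.\<close>
  have sq: "sqrt (v\<^sup>2 + m\<^sup>2) * sqrt (v\<^sup>2 + m\<^sup>2) = v * v + m * m" for v m :: real
    by (simp flip: power2_eq_square)
  show "eigenvector_field flux state_space lambda1 r1"
  proof (rule eigenvector_field_fluxI)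
    fix z :: "real ^ 2"
    assume "z \<in> state_space"
    then show "r1 z \<noteq> 0"
      by (auto simp: r1_def Let_def state_space_def vec_eq_iff forall_2)
    show "z$1 * r1 z$1 - z$2 * r1 z$2 = lambda1 z * r1 z$1"
      "- (z$2 * r1 z$1) - z$1 * r1 z$2 = lambda1 z * r1 z$2"
      using sq[of "z$1" "z$2"] by (simp_all add: r1_def lambda1_def Let_def algebra_simps)
  qed
  show "eigenvector_field flux state_space lambda2 r2"
  proof (rule eigenvector_field_fluxI)
    fix z :: "real ^ 2"
    assume "z \<in> state_space"
    then show "r2 z \<noteq> 0"
      by (auto simp: r2_def Let_def state_space_def vec_eq_iff forall_2)
    show "z$1 * r2 z$1 - z$2 * r2 z$2 = lambda2 z * r2 z$1"
      "- (z$2 * r2 z$1) - z$1 * r2 z$2 = lambda2 z * r2 z$2"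
      using sq[of "z$1" "z$2"] by (simp_all add: r2_def lambda2_def Let_def algebra_simps)
  qed
  have w: "w1 = (\<lambda>z. sqrt (((z$2)\<^sup>2 + (z$1)\<^sup>2) ^ 3) + (-1) * ((z$1) ^ 3 - 3 * z$1 * (z$2)\<^sup>2))"
    "w2 = (\<lambda>z. sqrt (((z$2)\<^sup>2 + (z$1)\<^sup>2) ^ 3) + 1 * ((z$1) ^ 3 - 3 * z$1 * (z$2)\<^sup>2))"
    by (auto simp: w1_def w2_def Let_def)
  show "riemann_invariant state_space r1 w1"
    unfolding riemann_invariant_def
  proof (intro conjI ballI exI)
    show "smooth_on state_space w1" unfolding w by (rule smooth_on_invariant)
    fix z assume z: "z \<in> state_space"
    show "GDERIV w1 z :> vector [3 * sqrt ((z$1)\<^sup>2 + (z$2)\<^sup>2) * z$1 + (-1) * (3 * (z$1)\<^sup>2 - 3 * (z$2)\<^sup>2),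
        3 * sqrt ((z$1)\<^sup>2 + (z$2)\<^sup>2) * z$2 - (-1) * (6 * z$1 * z$2)]"
      unfolding w by (rule GDERIV_invariant[OF z])
    \<comment> \<open>The second components force the scalar: \<open>3 s m + 6 v m\<close> divided
      by \<open>m\<close>. It vanishes where \<open>s = - 2 v\<close>, which the definition
      allows.\<close>
    show "vector [3 * sqrt ((z$1)\<^sup>2 + (z$2)\<^sup>2) * z$1 + (-1) * (3 * (z$1)\<^sup>2 - 3 * (z$2)\<^sup>2),
        3 * sqrt ((z$1)\<^sup>2 + (z$2)\<^sup>2) * z$2 - (-1) * (6 * z$1 * z$2)]
      = (3 * (sqrt ((z$1)\<^sup>2 + (z$2)\<^sup>2) + 2 * z$1)) *\<^sub>R r1 z"
      using sq[of "z$1" "z$2"]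
      by (simp add: vec_eq_iff forall_2 r1_def Let_def algebra_simps)
        (simp add: power2_eq_square[of "z$1"] power2_eq_square[of "z$2"])
  qed
  show "riemann_invariant state_space r2 w2"
    unfolding riemann_invariant_def
  proof (intro conjI ballI exI)
    show "smooth_on state_space w2" unfolding w by (rule smooth_on_invariant)
    fix z assume z: "z \<in> state_space"
    show "GDERIV w2 z :> vector [3 * sqrt ((z$1)\<^sup>2 + (z$2)\<^sup>2) * z$1 + 1 * (3 * (z$1)\<^sup>2 - 3 * (z$2)\<^sup>2),
        3 * sqrt ((z$1)\<^sup>2 + (z$2)\<^sup>2) * z$2 - 1 * (6 * z$1 * z$2)]"
      unfolding w by (rule GDERIV_invariant[OF z])
    \<comment> \<open>Here the scalar is \<open>3 s m - 6 v m\<close> divided by \<open>- m\<close>,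
      the second component of \<open>r2 z\<close>.\<close>
    show "vector [3 * sqrt ((z$1)\<^sup>2 + (z$2)\<^sup>2) * z$1 + 1 * (3 * (z$1)\<^sup>2 - 3 * (z$2)\<^sup>2),
        3 * sqrt ((z$1)\<^sup>2 + (z$2)\<^sup>2) * z$2 - 1 * (6 * z$1 * z$2)]
      = (3 * (2 * z$1 - sqrt ((z$1)\<^sup>2 + (z$2)\<^sup>2))) *\<^sub>R r2 z"
      using sq[of "z$1" "z$2"]
      by (simp add: vec_eq_iff forall_2 r2_def Let_def algebra_simps)
        (simp add: power2_eq_square[of "z$1"] power2_eq_square[of "z$2"])
  qed
qed

end
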